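(* Let $R$ be a finite valuation ring of order $q^r$ and let $A$ be a nonempty subset of $R$. If $|A+A||A|^{2}>q^{3r-1}$, then $$|A^2+A^2||A+A|\gg q^{\frac{r}{2}}|A|^{\frac{3}{2}}.$$
   Context: A finite valuation ring is a finite commutative ring with identity that is local and principal (every ideal is principal). Saying that $R$ is a finite valuation ring of order $q^r$ means that the residue field of $R$ (the quotient by its maximal ideal) has $q$ elements, that $r\ge 1$ is the nilpotency index of the maximal ideal (the least $r$ such that its $r$-th power is zero), and hence $|R|=q^r$. For nonempty $X,Y\subset R$: $X+Y=\{x+y: x\in X, y\in Y\}$. Also $A^2=\{a^2: a\in A\}$ denotes the set of squares of elements of $A$ (not the product set $AA$). $X\ll Y$ means there is an absolute constant $c>0$ (independent of $R$, $q$, $r$ and all the sets involved) with $X\le cY$; $X\gg Y$ means $Y\ll X$.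
   Formalization: q is assumed odd: for R=F_{2^n} and A an F_2-subspace of large codimension m<n/3 the claimed bound fails for every absolute constant. The constant is stated per carrier type; the type of natural numbers covers all finite rings up to isomorphism. *)

theory Defs
  imports Complex_Main "HOL-Algebra.Algebra"
begin

text \<open>A finite local principal commutative ring.  Fields are allowed (maximal ideal zero); the
  zero ring is not, since it has no maximal ideal.\<close>

definition finite_valuation_ring :: "('a, 'b) ring_scheme \<Rightarrow> bool" where
  "finite_valuation_ring R \<longleftrightarrow>
     cring R \<and> finite (carrier R) \<and>
     (\<exists>!M. maximalideal M R) \<and>
     (\<forall>I. ideal I R \<longrightarrow> principalideal I R)"

text \<open>Powers of an ideal are powers in the multiplicative monoid of \<^const>\<open>ideals_set\<close>, whose unit is
  the whole ring.\<close>

definition nilpotency_index :: "('a, 'b) ring_scheme \<Rightarrow> 'a set \<Rightarrow> nat \<Rightarrow> bool" where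
  "nilpotency_index R I r \<longleftrightarrow>
     I [^]\<^bsub>ideals_set R\<^esub> r = {\<zero>\<^bsub>R\<^esub>} \<and> (\<forall>k<r. I [^]\<^bsub>ideals_set R\<^esub> k \<noteq> {\<zero>\<^bsub>R\<^esub>})"

text \<open>Order \<open>q\<^sup>r\<close>: the residue field has \<open>q\<close> elements and the maximal ideal has nilpotency
  index \<open>r\<close>.\<close>

definition finite_valuation_ring_of_order :: "('a, 'b) ring_scheme \<Rightarrow> nat \<Rightarrow> nat \<Rightarrow> bool" where
  "finite_valuation_ring_of_order R q r \<longleftrightarrow>
     finite_valuation_ring R \<and> r \<ge> 1 \<and>
     (\<exists>M. maximalideal M R \<and> card (carrier (R Quot M)) = q \<and> nilpotency_index R M r)"

text \<open>The set of squares of elements of \<open>A\<close>, not the product set \<open>A A\<close>.\<close>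

definition squares :: "('a, 'b) ring_scheme \<Rightarrow> 'a set \<Rightarrow> 'a set" where
  "squares R A = (\<lambda>a. a [^]\<^bsub>R\<^esub> (2::nat)) ` A"

end

theory Submission
  imports Defs "HOL-Analysis.Convex"
begin

text \<open>For \<open>x, b \<in> A\<close> and \<open>c \<in> A\<^sup>2\<close> the point \<open>(x + b, x\<^sup>2 + c)\<close> lies on the parabola
  \<open>y = (t - b)\<^sup>2 + c\<close>, so the points \<open>(A + A) \<times> (A\<^sup>2 + A\<^sup>2)\<close> and the parabolas indexed by
  \<open>A \<times> A\<^sup>2\<close> have at least \<open>|A|\<^sup>2 |A\<^sup>2|\<close> incidences.  Two parabolas whose parameters \<open>b\<close> differ by a
  unit meet at most once, which bounds the variance of the number of parabolas through a point
  of \<open>R\<^sup>2\<close> and hence the number of incidences from above.  Write \<open>n = |R|\<close> and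
  \<open>X = |A\<^sup>2 + A\<^sup>2| |A + A|\<close>.  Either the main term dominates, and \<open>X \<ge> n |A| / 2\<close>, or
  \<open>X \<ge> q |A|\<^sup>3 |A\<^sup>2| / (4 n\<^sup>2)\<close>.  In the second case multiply this by the trivial bound
  \<open>X \<ge> |A\<^sup>2| |A + A|\<close>: as \<open>|A + A| |A|\<^sup>2 > n\<^sup>3 / q\<close>, the product is at least
  \<open>(|A\<^sup>2| / |A|)\<^sup>2 n |A|\<^sup>3 / 4\<close>.  Finally \<open>|A\<^sup>2|\<close> is comparable to \<open>|A|\<close>, because most elements of
  \<open>A\<close> are units and squaring is at most two-to-one on units.\<close>

section \<open>Incidences between points and translated graphs\<close>

text \<open>A pair \<open>l = (b, c)\<close> stands for the curve \<open>y = g b x + c\<close>, and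
  the sum counts triples of a point and two curves through it. By \<open>far\<close>, two curves
  with \<open>b' - b\<close> outside \<open>M\<close> share at most one point, so such pairs
  contribute at most |L|^2. The remaining, close pairs are counted crudely: a curve, an abscissa and
  the difference of parameters fix the whole triple.\<close>

lemma (in abelian_group) incidence_second_moment:
  fixes g :: "'a \<Rightarrow> 'a \<Rightarrow> 'a"
  assumes fin: "finite (carrier G)"
    and g: "\<And>b x. b \<in> carrier G \<Longrightarrow> x \<in> carrier G \<Longrightarrow> g b x \<in> carrier G"
    and M: "M \<subseteq> carrier G"
    and far: "\<And>b b' x x'. \<lbrakk>b \<in> carrier G; b' \<in> carrier G; x \<in> carrier G; x' \<in> carrier G; b' \<ominus> b \<notin> M;
        g b x \<ominus> g b' x = g b x' \<ominus> g b' x'\<rbrakk> \<Longrightarrow> x = x'"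
    and L: "L \<subseteq> carrier G \<times> carrier G"
  defines "I \<equiv> \<lambda>p. {l \<in> L. snd p = g (fst l) (fst p) \<oplus> snd l}"
  shows "(\<Sum>p\<in>carrier G \<times> carrier G. card (I p) ^ 2)
    \<le> card L ^ 2 + card L * (card (carrier G) * card M)"
proof -
  let ?C = "carrier G"
  let ?T = "SIGMA p:?C \<times> ?C. I p \<times> I p"
  let ?N = "{(p, l, l'). fst l' \<ominus> fst l \<in> M}"
  have finL: "finite L" and finM: "finite M"
    using fin L M by (auto intro: finite_subset)
  have finI: "finite (I p)" for p
    using finL by (simp add: I_def)
  have finT: "finite ?T"
    using fin finI by simp
  \<comment> \<open>Far pairs: the two curves alone determine the common point.\<close>
  have "card (?T - ?N) \<le> card (L \<times> L)"
  proof (rule card_inj_on_le)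
    show "inj_on snd (?T - ?N)"
    proof (rule inj_onI, clarsimp)
      fix x y x' y' b c b' c'
      assume C: "x \<in> ?C" "y \<in> ?C" "x' \<in> ?C" "y' \<in> ?C"
        and I: "(b, c) \<in> I (x, y)" "(b', c') \<in> I (x, y)" "(b, c) \<in> I (x', y')" "(b', c') \<in> I (x', y')"
        and N: "b' \<ominus> b \<notin> M"
      have B: "b \<in> ?C" "b' \<in> ?C" "c \<in> ?C" "c' \<in> ?C"
        using I L by (auto simp: I_def)
      have eq: "y = g b x \<oplus> c" "y = g b' x \<oplus> c'" "y' = g b x' \<oplus> c" "y' = g b' x' \<oplus> c'"
        using I by (auto simp: I_def)
      \<comment> \<open>Equating the two expressions for the ordinate shows that
        \<open>g b - g b'\<close> takes the same value \<open>c' - c\<close> at both abscissas,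
        which is the premise of \<open>far\<close>.\<close>
      have diff: "u \<ominus> v = c' \<ominus> c" if "u \<in> ?C" "v \<in> ?C" "u \<oplus> c = v \<oplus> c'" for u v
      proof -
        have "u = (u \<oplus> c) \<ominus> c"
          using that(1,2) B by (simp add: a_minus_def a_assoc r_neg)
        also have "\<dots> = (c' \<ominus> c) \<oplus> v"
          unfolding that(3) using that(1,2) B by (simp add: a_minus_def a_ac)
        finally have "u \<ominus> v = ((c' \<ominus> c) \<oplus> v) \<ominus> v"
          by simp
        also have "\<dots> = c' \<ominus> c"
          using that B by (simp add: a_minus_def a_assoc r_neg)
        finally show ?thesis .
      qed
      have "x = x'"
        using far[OF B(1,2) C(1,3) N] diff[of "g b x" "g b' x"] diff[of "g b x'" "g b' x'"] eq g B C
        by auto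
      then show "x = x' \<and> y = y'"
        using eq by simp
    qed
    show "snd ` (?T - ?N) \<subseteq> L \<times> L"
      by (auto simp: I_def)
  qed (use finL in simp)
  then have 1: "card (?T - ?N) \<le> card L ^ 2"
    by (simp add: card_cartesian_product power2_eq_square)
  \<comment> \<open>the curve \<open>l\<close> and \<open>x\<close> determine \<open>y\<close>, and then \<open>b'\<close> determines \<open>c'\<close>\<close>
  have "card (?T \<inter> ?N) \<le> card (L \<times> (?C \<times> M))"
  proof (rule card_inj_on_le)
    let ?f = "\<lambda>(p, l, l'). (l, fst p, fst l' \<ominus> fst l)"
    show "inj_on ?f (?T \<inter> ?N)"
    proof (rule inj_onI, clarsimp)
      fix x y y' b c b' c' b'' c''
      assume C: "x \<in> ?C" "y \<in> ?C" "y' \<in> ?C"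
        and I: "(b, c) \<in> I (x, y)" "(b', c') \<in> I (x, y)" "(b, c) \<in> I (x, y')" "(b'', c'') \<in> I (x, y')"
        and N: "b' \<ominus> b = b'' \<ominus> b"
      have B: "b \<in> ?C" "b' \<in> ?C" "c \<in> ?C" "c' \<in> ?C" "b'' \<in> ?C" "c'' \<in> ?C"
        using I L by (auto simp: I_def)
      have eq: "y = g b x \<oplus> c" "y = g b' x \<oplus> c'" "y' = g b x \<oplus> c" "y' = g b'' x \<oplus> c''"
        using I by (auto simp: I_def)
      have b: "b' = b''"
        using N B by (simp add: a_minus_def)
      then have "g b' x \<oplus> c' = g b' x \<oplus> c''"
        using eq by simp
      then have "c' = c''"
        using B C g by simp
      with b eq show "y = y' \<and> b' = b'' \<and> c' = c''"
        by simp
    qed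
    show "?f ` (?T \<inter> ?N) \<subseteq> L \<times> (?C \<times> M)"
      by (auto simp: I_def)
  qed (use finL fin finM in simp)
  then have 2: "card (?T \<inter> ?N) \<le> card L * (card ?C * card M)"
    by (simp add: card_cartesian_product)
  have "(\<Sum>p\<in>?C \<times> ?C. card (I p) ^ 2) = card ?T"
    using fin finI by (simp add: card_SigmaI card_cartesian_product power2_eq_square)
  also have "\<dots> = card (?T - ?N) + card (?T \<inter> ?N)"
    using finT card_Diff_subset_Int[of ?T ?N] card_mono[of ?T "?T \<inter> ?N"] by simp
  finally show ?thesis
    using 1 2 by linarith
qed

text \<open>A variance argument: |L| / n, with n the order of the group, is the mean number of
  curves through a point of the plane. The second moment bounds the total squared deviation from
  this mean, and Cauchy-Schwarz passes from the plane to \<open>P\<close>.\<close>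

lemma (in abelian_group) incidence_bound:
  fixes g :: "'a \<Rightarrow> 'a \<Rightarrow> 'a"
  assumes fin: "finite (carrier G)"
    and g: "\<And>b x. b \<in> carrier G \<Longrightarrow> x \<in> carrier G \<Longrightarrow> g b x \<in> carrier G"
    and M: "M \<subseteq> carrier G"
    and far: "\<And>b b' x x'. \<lbrakk>b \<in> carrier G; b' \<in> carrier G; x \<in> carrier G; x' \<in> carrier G; b' \<ominus> b \<notin> M;
        g b x \<ominus> g b' x = g b x' \<ominus> g b' x'\<rbrakk> \<Longrightarrow> x = x'"
    and L: "L \<subseteq> carrier G \<times> carrier G" and P: "P \<subseteq> carrier G \<times> carrier G"
  defines "I \<equiv> \<lambda>p. {l \<in> L. snd p = g (fst l) (fst p) \<oplus> snd l}"
  shows "(real (\<Sum>p\<in>P. card (I p)) - real (card P) * real (card L) / real (card (carrier G)))\<^sup>2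
    \<le> real (card P) * real (card L) * (real (card (carrier G)) * real (card M))"
proof -
  let ?C = "carrier G"
  define n where "n = card ?C"
  define d where "d = real (card L) / real n"
  have n: "n > 0"
    using fin by (auto simp: n_def card_gt_0_iff)
  have finL: "finite L" and finP: "finite P"
    using finite_subset[OF L] finite_subset[OF P] fin by simp_all
  have finI: "finite (I p)" for p
    using finL by (simp add: I_def)
  \<comment> \<open>Every curve has exactly one point over each abscissa, so the plane carries n |L|
    incidences and \<open>d\<close> is their average per point.\<close>
  have "card (SIGMA p:?C \<times> ?C. I p) = card (L \<times> ?C)"
  proof (rule bij_betw_same_card)
    show "bij_betw (\<lambda>(p, l). (l, fst p)) (SIGMA p:?C \<times> ?C. I p) (L \<times> ?C)"
      by (rule bij_betw_byWitness[where f' = "\<lambda>(l, x). ((x, g (fst l) x \<oplus> snd l), l)"])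
        (use L g in \<open>auto simp: I_def\<close>)
  qed
  then have first: "(\<Sum>p\<in>?C \<times> ?C. real (card (I p))) = real n * real (card L)"
    using fin finI by (simp add: card_SigmaI card_cartesian_product n_def flip: of_nat_sum of_nat_mult)
  have second: "(\<Sum>p\<in>?C \<times> ?C. real (card (I p)) ^ 2)
      \<le> real (card L) ^ 2 + real (card L) * (real n * real (card M))"
  proof -
    have "(\<Sum>p\<in>?C \<times> ?C. card (I p) ^ 2) \<le> card L ^ 2 + card L * (n * card M)"
      unfolding I_def n_def by (rule incidence_second_moment[where g = g]) (fact fin g M far L)+
    then have "real (\<Sum>p\<in>?C \<times> ?C. card (I p) ^ 2) \<le> real (card L ^ 2 + card L * (n * card M))"
      by (rule of_nat_mono)
    then show ?thesis
      by simp
  qed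
  \<comment> \<open>The cross term and the constant term add up to -|L|^2, which cancels the
    contribution of the far pairs; only the close pairs remain.\<close>
  have "(\<Sum>p\<in>?C \<times> ?C. (real (card (I p)) - d)\<^sup>2)
      = (\<Sum>p\<in>?C \<times> ?C. real (card (I p)) ^ 2) - 2 * (\<Sum>p\<in>?C \<times> ?C. real (card (I p))) * d
        + (real n)\<^sup>2 * d\<^sup>2"
    by (simp add: power2_diff sum.distrib sum_subtractf card_cartesian_product n_def
        flip: sum_distrib_left sum_distrib_right) (simp add: power2_eq_square)
  also have "\<dots> = (\<Sum>p\<in>?C \<times> ?C. real (card (I p)) ^ 2) - real (card L) ^ 2"
    using n by (simp add: first d_def power2_eq_square)
  also have "\<dots> \<le> real (card L) * (real n * real (card M))"
    using second by simp
  finally have variance: "(\<Sum>p\<in>?C \<times> ?C. (real (card (I p)) - d)\<^sup>2) \<le> real (card L) * (real n * real (card M))" .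
  have "real (\<Sum>p\<in>P. card (I p)) - real (card P) * d = (\<Sum>p\<in>P. real (card (I p)) - d)"
    by (simp add: sum_subtractf)
  then have "(real (\<Sum>p\<in>P. card (I p)) - real (card P) * d)\<^sup>2 = (\<Sum>p\<in>P. real (card (I p)) - d)\<^sup>2"
    by (rule arg_cong)
  also have "\<dots> \<le> real (card P) * (\<Sum>p\<in>P. (real (card (I p)) - d)\<^sup>2)"
    using sum_squared_le_sum_of_squares[of "\<lambda>p. real (card (I p)) - d" P] by (simp add: mult.commute)
  also have "\<dots> \<le> real (card P) * (\<Sum>p\<in>?C \<times> ?C. (real (card (I p)) - d)\<^sup>2)"
    using fin P by (auto intro!: mult_left_mono sum_mono2)
  also have "\<dots> \<le> real (card P) * (real (card L) * (real n * real (card M)))"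
    by (intro mult_left_mono variance) simp
  finally show ?thesis
    by (simp add: d_def n_def mult_ac)
qed

section \<open>Powers of a principal nilpotent maximal ideal\<close>

text \<open>This turns the nilpotency index, defined by powers of an ideal, into a condition on the
  powers of a generator.\<close>

lemma (in cring) ideals_set_pow_PIdl:
  assumes p: "p \<in> carrier R"
  shows "(PIdl p) [^]\<^bsub>ideals_set R\<^esub> (k::nat) = PIdl (p [^] k)"
proof (induction k)
  case 0
  have "PIdl \<one> = carrier R"
    using cgenideal_self[of \<one>] ideal.one_imp_carrier[OF cgenideal_ideal[of \<one>]] by simp
  then show ?case
    by (simp add: nat_pow_def ideals_set_def)
next
  case (Suc k)
  have "(PIdl p) [^]\<^bsub>ideals_set R\<^esub> Suc k = (PIdl (p [^] k)) \<cdot> (PIdl p)"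
    using Suc by (simp add: nat_pow_def ideals_set_def)
  also have "\<dots> = Idl ((PIdl (p [^] k)) <#> (PIdl p))"
    using p by (intro ideal_prod_eq_genideal cgenideal_ideal) auto
  also have "\<dots> = Idl (PIdl (p [^] Suc k))"
    using p by (simp add: cgenideal_prod)
  also have "\<dots> = PIdl (p [^] Suc k)"
    using p by (intro antisym genideal_minimal genideal_self cgenideal_ideal subset_refl
        additive_subgroup.a_subset[OF ideal.axioms(1)]) simp_all
  finally show ?case .
qed

text \<open>By maximality \<open>M\<close> and \<open>d\<close> generate the ring, so 1 = m + y d
  with m in \<open>M\<close>. Multiplying by \<open>x\<close> gives x = m x, and iterating gives x =
  m^r x = 0.\<close>

lemma (in cring) nil_maximal_cancel:
  assumes M: "maximalideal M R" and nil: "\<And>m. m \<in> M \<Longrightarrow> m [^] (r::nat) = \<zero>"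
    and d: "d \<in> carrier R" "d \<notin> M" and x: "x \<in> carrier R" "d \<otimes> x = \<zero>"
  shows "x = \<zero>"
proof -
  interpret M: maximalideal M R by fact
  have "ideal (M <+>\<^bsub>R\<^esub> (PIdl d)) R"
    using d M.ideal_axioms cgenideal_ideal by (intro add_ideals) auto
  moreover have "M \<subseteq> M <+>\<^bsub>R\<^esub> (PIdl d)"
  proof
    fix m assume "m \<in> M"
    then have "m \<oplus> \<zero> \<in> M <+>\<^bsub>R\<^esub> (PIdl d)"
      using d additive_subgroup.zero_closed[OF ideal.axioms(1)[OF cgenideal_ideal[of d]]]
      using \<open>m \<in> M\<close> unfolding set_add_def' by blast
    then show "m \<in> M <+>\<^bsub>R\<^esub> (PIdl d)"
      using \<open>m \<in> M\<close> M.Icarr by simp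
  qed
  moreover have "d \<in> M <+>\<^bsub>R\<^esub> (PIdl d)"
  proof -
    have "\<zero> \<oplus> d \<in> M <+>\<^bsub>R\<^esub> (PIdl d)"
      using cgenideal_self[of d] d M.zero_closed unfolding set_add_def' by blast
    then show ?thesis using d by simp
  qed
  ultimately have "M <+>\<^bsub>R\<^esub> (PIdl d) = carrier R"
    using d M.I_maximal ideal.Icarr by (metis subsetI)
  then have "\<one> \<in> M <+>\<^bsub>R\<^esub> (PIdl d)"
    by simp
  then obtain m y where m: "m \<in> M" and y: "y \<in> carrier R" and one: "\<one> = m \<oplus> y \<otimes> d"
    unfolding set_add_def' cgenideal_def by auto
  have mC: "m \<in> carrier R"
    using m M.Icarr by simp
  have "x = (m \<oplus> y \<otimes> d) \<otimes> x"
    using x by (simp flip: one)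
  also have "\<dots> = m \<otimes> x \<oplus> y \<otimes> (d \<otimes> x)"
    using mC y d x by (simp add: l_distr m_assoc)
  finally have fix_x: "m \<otimes> x = x"
    using mC x y by simp
  have "m [^] (k::nat) \<otimes> x = x" for k
    by (induction k) (use mC x fix_x in \<open>auto simp: m_assoc\<close>)
  then have "x = m [^] r \<otimes> x"
    by simp
  then show "x = \<zero>"
    using nil[OF m] x by simp
qed

lemma (in cring) PIdl_nilpotent:
  assumes p: "p \<in> carrier R" "p [^] (r::nat) = \<zero>" and m: "m \<in> PIdl p"
  shows "m [^] r = \<zero>"
proof -
  obtain x where "x \<in> carrier R" "m = x \<otimes> p"
    using m unfolding cgenideal_def by blast
  then show ?thesis
    using p by (simp add: nat_pow_distrib)
qed

text \<open>The quotient (p^i) / (p^(i+1)) is one-dimensional over the residue field: each element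
  of (p^i) is uniquely p^i times the chosen representative of a residue class plus an element of
  (p^(i+1)).\<close>

lemma (in cring) card_PIdl_pow_step:
  assumes M: "maximalideal (PIdl p) R" and p: "p \<in> carrier R"
    and nil: "\<And>m. m \<in> PIdl p \<Longrightarrow> m [^] (r::nat) = \<zero>" and nz: "p [^] (i::nat) \<noteq> \<zero>"
  shows "card (PIdl (p [^] i)) = card (carrier (R Quot PIdl p)) * card (PIdl (p [^] Suc i))"
proof -
  let ?M = "PIdl p"
  interpret M: maximalideal ?M R by fact
  define rep where "rep C = (SOME x. x \<in> carrier R \<and> C = ?M +> x)" for C
  have rep: "rep C \<in> carrier R" "C = ?M +> rep C" if "C \<in> a_rcosets ?M" for C
  proof -
    have "\<exists>x. x \<in> carrier R \<and> C = ?M +> x"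
      using that by (auto simp: A_RCOSETS_def')
    from someI_ex[OF this] show "rep C \<in> carrier R" "C = ?M +> rep C"
      by (simp_all add: rep_def)
  qed
  have pi: "p [^] i \<in> carrier R"
    using p by simp
  \<comment> \<open>Changing \<open>u\<close> by an element of \<open>?M\<close> changes p^i u by an
    element of (p^(i+1)); both injectivity and surjectivity rest on this.\<close>
  have factor: "(u \<oplus> y \<otimes> p) \<otimes> p [^] i = p [^] i \<otimes> u \<oplus> y \<otimes> p [^] Suc i"
    if "u \<in> carrier R" "y \<in> carrier R" for u y
    using that p pi by (simp add: l_distr r_distr m_ac)
  let ?f = "\<lambda>(C, z). p [^] i \<otimes> rep C \<oplus> z"
  have "bij_betw ?f ((a_rcosets ?M) \<times> (PIdl (p [^] Suc i))) (PIdl (p [^] i))"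
  proof (rule bij_betw_imageI)
    show "inj_on ?f ((a_rcosets ?M) \<times> (PIdl (p [^] Suc i)))"
    proof (rule inj_onI, clarify)
      fix C z C' z'
      assume C: "C \<in> a_rcosets ?M" "C' \<in> a_rcosets ?M"
        and z: "z \<in> PIdl (p [^] Suc i)" "z' \<in> PIdl (p [^] Suc i)"
        and eq: "p [^] i \<otimes> rep C \<oplus> z = p [^] i \<otimes> rep C' \<oplus> z'"
      obtain y y' where y: "y \<in> carrier R" "y' \<in> carrier R"
        and zy: "z = y \<otimes> p [^] Suc i" "z' = y' \<otimes> p [^] Suc i"
        using z unfolding cgenideal_def by blast
      let ?v = "rep C \<oplus> y \<otimes> p" and ?v' = "rep C' \<oplus> y' \<otimes> p"
      have v: "?v \<in> carrier R" "?v' \<in> carrier R"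
        using y p rep(1)[OF C(1)] rep(1)[OF C(2)] by simp_all
      have "(?v \<ominus> ?v') \<otimes> p [^] i = ?v \<otimes> p [^] i \<ominus> ?v' \<otimes> p [^] i"
        using v pi by (simp add: a_minus_def l_distr l_minus)
      also have "\<dots> = (p [^] i \<otimes> rep C \<oplus> z) \<ominus> (p [^] i \<otimes> rep C' \<oplus> z')"
        unfolding zy factor[OF rep(1)[OF C(1)] y(1)] factor[OF rep(1)[OF C(2)] y(2)] ..
      also have "\<dots> = \<zero>"
        unfolding eq unfolding zy using y p pi rep(1)[OF C(2)] by (simp add: a_minus_def r_neg)
      \<comment> \<open>A factor outside \<open>?M\<close> could be cancelled, forcing p^i = 0
        against \<open>nz\<close>.\<close>
      finally have "?v \<ominus> ?v' \<in> ?M"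
        using nil_maximal_cancel[OF M nil _ _ pi] v nz by blast
      then have "?M +> ?v = ?M +> ?v'"
        using quotient_eq_iff_same_a_r_cos[OF M.ideal_axioms v] by simp
      moreover have "?M +> (rep D \<oplus> w \<otimes> p) = D" if D: "D \<in> a_rcosets ?M" and w: "w \<in> carrier R" for D w
      proof -
        have "(rep D \<oplus> w \<otimes> p) \<ominus> rep D = w \<otimes> p"
          using w p rep(1)[OF D] by algebra
        moreover have "w \<otimes> p \<in> ?M"
          using w unfolding cgenideal_def by blast
        ultimately have "(rep D \<oplus> w \<otimes> p) \<ominus> rep D \<in> ?M"
          by (simp only:)
        then have "?M +> (rep D \<oplus> w \<otimes> p) = ?M +> rep D"
          using w p rep(1)[OF D] quotient_eq_iff_same_a_r_cos[OF M.ideal_axioms, of "rep D \<oplus> w \<otimes> p" "rep D"] by simp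
        then show ?thesis
          using rep(2)[OF D] by simp
      qed
      ultimately have "C = C'"
        using C y by simp
      moreover have "z = z'"
        using eq \<open>C = C'\<close> y p pi rep(1)[OF C(2)] unfolding zy by simp
      ultimately show "C = C' \<and> z = z'" ..
    qed
    show "?f ` ((a_rcosets ?M) \<times> (PIdl (p [^] Suc i))) = PIdl (p [^] i)"
    proof (intro antisym subsetI)
      fix w assume "w \<in> ?f ` ((a_rcosets ?M) \<times> (PIdl (p [^] Suc i)))"
      then obtain C z where C: "C \<in> a_rcosets ?M" and z: "z \<in> PIdl (p [^] Suc i)"
        and w: "w = p [^] i \<otimes> rep C \<oplus> z"
        by (elim imageE SigmaE) auto
      obtain y where y: "y \<in> carrier R" and zy: "z = y \<otimes> p [^] Suc i"
        using z unfolding cgenideal_def by blast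
      have "w = (rep C \<oplus> y \<otimes> p) \<otimes> p [^] i"
        unfolding w zy factor[OF rep(1)[OF C] y] ..
      moreover have "rep C \<oplus> y \<otimes> p \<in> carrier R"
        using y p rep(1)[OF C] by simp
      ultimately show "w \<in> PIdl (p [^] i)"
        unfolding cgenideal_def by blast
    next
      fix w assume "w \<in> PIdl (p [^] i)"
      then obtain x where x: "x \<in> carrier R" and w: "w = x \<otimes> p [^] i"
        unfolding cgenideal_def by blast
      define C where "C = ?M +> x"
      have C: "C \<in> a_rcosets ?M"
        using x by (auto simp: A_RCOSETS_def' C_def)
      have "x \<ominus> rep C \<in> ?M"
        using quotient_eq_iff_same_a_r_cos[OF M.ideal_axioms] rep[OF C] x C_def by metis
      then obtain y where y: "y \<in> carrier R" and xy: "x \<ominus> rep C = y \<otimes> p"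
        unfolding cgenideal_def by blast
      have "x = rep C \<oplus> (x \<ominus> rep C)"
        using x rep(1)[OF C] by algebra
      then have "w = (rep C \<oplus> y \<otimes> p) \<otimes> p [^] i"
        using w xy by simp
      also have "\<dots> = p [^] i \<otimes> rep C \<oplus> y \<otimes> p [^] Suc i"
        by (rule factor[OF rep(1)[OF C] y])
      finally have "w = ?f (C, y \<otimes> p [^] Suc i)"
        by simp
      moreover have "(C, y \<otimes> p [^] Suc i) \<in> (a_rcosets ?M) \<times> (PIdl (p [^] Suc i))"
        using C y unfolding cgenideal_def by blast
      ultimately show "w \<in> ?f ` ((a_rcosets ?M) \<times> (PIdl (p [^] Suc i)))"
        by (rule image_eqI)
    qed
  qed
  then have "card (PIdl (p [^] i)) = card ((a_rcosets ?M) \<times> (PIdl (p [^] Suc i)))"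
    by (simp add: bij_betw_same_card)
  then show ?thesis
    by (simp add: card_cartesian_product FactRing_def)
qed

text \<open>The chain (0) = (p^r), (p^(r-1)), ..., (1) grows by the factor q at each of its r steps,
  q being the size of the residue field. The induction climbs from (0), hence the exponent
  \<open>r - j\<close>.\<close>

lemma (in cring) card_nilpotent_PIdl:
  assumes M: "maximalideal (PIdl p) R" and p: "p \<in> carrier R"
    and nil: "p [^] (r::nat) = \<zero>" and nz: "\<And>k::nat. k < r \<Longrightarrow> p [^] k \<noteq> \<zero>"
  shows "card (carrier R) = card (carrier (R Quot PIdl p)) ^ r"
proof -
  have "card (PIdl (p [^] (r - j))) = card (carrier (R Quot PIdl p)) ^ j" if "j \<le> r" for j
    using that
  proof (induction j)
    case 0
    have "PIdl \<zero> = {\<zero>}"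
      by (auto simp: cgenideal_def intro!: exI[of _ \<zero>])
    then show ?case
      using nil by simp
  next
    case (Suc j)
    then have "card (PIdl (p [^] (r - Suc j)))
        = card (carrier (R Quot PIdl p)) * card (PIdl (p [^] Suc (r - Suc j)))"
      by (intro card_PIdl_pow_step[OF M p PIdl_nilpotent[OF p nil] nz]) auto
    then show ?case
      using Suc by (simp add: Suc_diff_Suc del: nat_pow_Suc)
  qed
  from this[of r] have "card (PIdl \<one>) = card (carrier (R Quot PIdl p)) ^ r"
    by simp
  moreover have "PIdl \<one> = carrier R"
    using cgenideal_self[of \<one>] ideal.one_imp_carrier[OF cgenideal_ideal[of \<one>]] by simp
  ultimately show ?thesis
    by simp
qed

section \<open>Doubling and squaring in odd order\<close>

text \<open>In odd order 2 is a unit: there is no 2-torsion, so doubling is injective, hence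
  surjective on a finite ring, and 1 = y + y for some \<open>y\<close>. Then x = (x + x) y lies in
  any ideal containing x + x.\<close>

lemma (in cring) odd_card_double_notin_ideal:
  assumes fin: "finite (carrier R)" and odd: "odd (card (carrier R))"
    and M: "ideal M R" and x: "x \<in> carrier R" "x \<notin> M"
  shows "x \<oplus> x \<notin> M"
proof
  assume xM: "x \<oplus> x \<in> M"
  have zero: "y = \<zero>" if y: "y \<in> carrier R" "y \<oplus> y = \<zero>" for y
  proof -
    obtain k where k: "card (carrier R) = 2 * k + 1"
      using odd by (auto elim: oddE)
    \<comment> \<open>A 2-torsion element is killed by \<open>2 * k\<close> and, by Lagrange, by the
      group order \<open>2 * k + 1\<close>, hence is zero.\<close>
    have "add_pow R (2 * k) y = \<zero>"
      by (induction k) (use y in \<open>auto simp: a_assoc\<close>)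
    then have "add_pow R (2 * k + 1) y = y"
      using y by simp
    moreover have "add_pow R (card (carrier R)) y = \<zero>"
      using add.pow_order_eq_1[OF y(1)] by (simp add: order_def)
    ultimately show ?thesis
      using k by simp
  qed
  have "inj_on (\<lambda>y. y \<oplus> y) (carrier R)"
  proof (rule inj_onI)
    fix y z assume yz: "y \<in> carrier R" "z \<in> carrier R" "y \<oplus> y = z \<oplus> z"
    have "(y \<ominus> z) \<oplus> (y \<ominus> z) = (y \<oplus> y) \<ominus> (z \<oplus> z)"
      using yz(1,2) by algebra
    then have "y \<ominus> z = \<zero>"
      using zero[of "y \<ominus> z"] yz by (simp add: a_minus_def r_neg)
    then show "y = z"
      using yz by simp
  qed
  then have "(\<lambda>y. y \<oplus> y) ` carrier R = carrier R"
    using fin by (intro endo_inj_surj) auto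
  then have "\<one> \<in> (\<lambda>y. y \<oplus> y) ` carrier R"
    by simp
  then obtain y where y: "y \<in> carrier R" "\<one> = y \<oplus> y"
    by blast
  have "x = x \<otimes> (y \<oplus> y)"
    using x by (simp flip: y(2))
  also have "\<dots> = (x \<oplus> x) \<otimes> y"
    using x(1) y(1) by algebra
  also have "\<dots> \<in> M"
    using xM y(1) ideal.I_r_closed[OF M] by simp
  finally show False
    using x by simp
qed

text \<open>If x^2 = y^2 then (x - y)(x + y) = 0. The two factors add up to 2x, which is outside
  \<open>M\<close>, so one of them is outside \<open>M\<close> and can be cancelled. Hence y = x or
  y = -x, and the fibres of squaring on \<open>S\<close> have at most two elements.\<close>

lemma (in cring) card_le_twice_card_squares:
  assumes fin: "finite (carrier R)" and M: "ideal M R"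
    and cancel: "\<And>d x. \<lbrakk>d \<in> carrier R; d \<notin> M; x \<in> carrier R; d \<otimes> x = \<zero>\<rbrakk> \<Longrightarrow> x = \<zero>"
    and double: "\<And>x. \<lbrakk>x \<in> carrier R; x \<notin> M\<rbrakk> \<Longrightarrow> x \<oplus> x \<notin> M"
    and S: "S \<subseteq> carrier R - M"
  shows "card S \<le> 2 * card (squares R S)"
proof -
  interpret M: ideal M R by fact
  let ?F = "\<lambda>z. {x \<in> S. x [^] (2::nat) = z}"
  have finS: "finite S"
    using S fin by (auto intro: finite_subset)
  have fibre: "card (?F z) \<le> 2" if z: "z \<in> squares R S" for z
  proof -
    obtain x where x: "x \<in> S" "z = x [^] (2::nat)"
      using z unfolding squares_def by blast
    have xC: "x \<in> carrier R" "x \<notin> M"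
      using x S by auto
    have "?F z \<subseteq> {x, \<ominus> x}"
    proof
      fix y assume "y \<in> ?F z"
      then have y: "y \<in> carrier R" "y \<otimes> y = x \<otimes> x"
        using S x xC by (auto simp: numeral_2_eq_2)
      have "(x \<ominus> y) \<otimes> (x \<oplus> y) = x \<otimes> x \<ominus> y \<otimes> y"
        using xC(1) y(1) by algebra
      then have prod: "(x \<ominus> y) \<otimes> (x \<oplus> y) = \<zero>" "(x \<oplus> y) \<otimes> (x \<ominus> y) = \<zero>"
        using xC y by (simp_all add: a_minus_def r_neg m_comm)
      have "(x \<ominus> y) \<oplus> (x \<oplus> y) = x \<oplus> x"
        using xC(1) y(1) by algebra
      then have "x \<ominus> y \<notin> M \<or> x \<oplus> y \<notin> M"
        using double[OF xC] M.a_closed by metis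
      then have "x \<oplus> y = \<zero> \<or> x \<ominus> y = \<zero>"
        using cancel[OF _ _ _ prod(1)] cancel[OF _ _ _ prod(2)] xC y by auto
      moreover have "y = \<ominus> x" if "x \<oplus> y = \<zero>"
        using that xC y a_comm minus_equality by metis
      ultimately show "y \<in> {x, \<ominus> x}"
        using xC y by auto
    qed
    then have "card (?F z) \<le> card {x, \<ominus> x}"
      by (rule card_mono[rotated]) simp
    also have "\<dots> \<le> 2"
      by (simp add: card_insert_if)
    finally show ?thesis .
  qed
  have "S = (\<Union>z\<in>squares R S. ?F z)"
    by (auto simp: squares_def)
  then have "card S \<le> (\<Sum>z\<in>squares R S. card (?F z))"
    using card_UN_le[of "squares R S" ?F] finS by (simp add: squares_def)
  also have "\<dots> \<le> card (squares R S) * 2"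
    using sum_bounded_above[of "squares R S" "\<lambda>z. card (?F z)" 2] fibre by simp
  finally show ?thesis
    by simp
qed

section \<open>Parabolas and the points of the sumsets\<close>

text \<open>At least a^2 u incidences exist, while \<open>incidence_bound\<close> allows at most W a
  u / n plus the square root of W a u n |M|. One of these two terms is at least a^2 u / 2, which
  gives the two alternatives.\<close>

lemma (in cring) sumset_squares_incidences:
  assumes fin: "finite (carrier R)" and M: "ideal M R"
    and cancel: "\<And>d x. \<lbrakk>d \<in> carrier R; d \<notin> M; x \<in> carrier R; d \<otimes> x = \<zero>\<rbrakk> \<Longrightarrow> x = \<zero>"
    and double: "\<And>x. \<lbrakk>x \<in> carrier R; x \<notin> M\<rbrakk> \<Longrightarrow> x \<oplus> x \<notin> M"
    and A: "A \<subseteq> carrier R" "A \<noteq> {}"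
  defines "a \<equiv> real (card A)" and "n \<equiv> real (card (carrier R))" and "u \<equiv> real (card (squares R A))"
    and "W \<equiv> real (card (squares R A <+>\<^bsub>R\<^esub> squares R A)) * real (card (A <+>\<^bsub>R\<^esub> A))"
  shows "a * n \<le> 2 * W \<or> a ^ 3 * u \<le> 4 * W * (n * real (card M))"
proof -
  interpret M: ideal M R by fact
  let ?C = "carrier R"
  define g where "g b x = (x \<ominus> b) [^] (2::nat)" for b x
  define P where "P = (A <+>\<^bsub>R\<^esub> A) \<times> (squares R A <+>\<^bsub>R\<^esub> squares R A)"
  define L where "L = A \<times> squares R A"
  define I where "I = (\<lambda>p. {l \<in> L. snd p = g (fst l) (fst p) \<oplus> snd l})"
  have sqC: "squares R A \<subseteq> ?C"
    using A by (auto simp: squares_def)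
  have PC: "P \<subseteq> ?C \<times> ?C" and LC: "L \<subseteq> ?C \<times> ?C"
    using set_add_closed[OF A(1) A(1)] set_add_closed[OF sqC sqC] A sqC by (auto simp: P_def L_def)
  have finP: "finite P" and finL: "finite L"
    using finite_subset[OF PC] finite_subset[OF LC] fin by simp_all
  have finI: "finite (I p)" for p
    using finL by (simp add: I_def)
  have far: "x = x'" if C: "b \<in> ?C" "b' \<in> ?C" "x \<in> ?C" "x' \<in> ?C" and N: "b' \<ominus> b \<notin> M"
    and eq: "g b x \<ominus> g b' x = g b x' \<ominus> g b' x'" for b b' x x'
  proof -
    have sq: "g v w = (w \<ominus> v) \<otimes> (w \<ominus> v)" if "v \<in> ?C" "w \<in> ?C" for v w
      using that by (simp add: g_def numeral_2_eq_2)
    \<comment> \<open>The difference of two such parabolas is affine in \<open>x\<close> with slope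
      2(b' - b); the slope is outside \<open>M\<close> by \<open>double\<close>, so it can be
      cancelled.\<close>
    have "((b' \<ominus> b) \<oplus> (b' \<ominus> b)) \<otimes> (x \<ominus> x')
        = ((x \<ominus> b) \<otimes> (x \<ominus> b) \<ominus> (x \<ominus> b') \<otimes> (x \<ominus> b'))
          \<ominus> ((x' \<ominus> b) \<otimes> (x' \<ominus> b) \<ominus> (x' \<ominus> b') \<otimes> (x' \<ominus> b'))"
      using C by algebra
    also have "\<dots> = (g b x \<ominus> g b' x) \<ominus> (g b x' \<ominus> g b' x')"
      using C by (simp add: sq)
    also have "\<dots> = \<zero>"
      unfolding eq using C by (simp add: sq a_minus_def r_neg)
    finally have "x \<ominus> x' = \<zero>"
      using cancel[OF _ double[OF _ N]] C by simp
    then show ?thesis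
      using C by simp
  qed
  have "card A ^ 2 * card (squares R A) = card (A \<times> L)"
    by (simp add: L_def card_cartesian_product power2_eq_square)
  also have "\<dots> \<le> card (SIGMA p:P. I p)"
  proof (rule card_inj_on_le)
    let ?f = "\<lambda>(x, l). ((x \<oplus> fst l, x [^] (2::nat) \<oplus> snd l), l)"
    show "inj_on ?f (A \<times> L)"
      using A LC by (intro inj_onI) (auto simp: subset_iff)
    show "?f ` (A \<times> L) \<subseteq> (SIGMA p:P. I p)"
    proof (rule image_subsetI)
      fix v assume "v \<in> A \<times> L"
      then obtain x b c where v: "v = (x, (b, c))" and x: "x \<in> A" and b: "b \<in> A" and c: "c \<in> squares R A"
        by (auto simp: L_def)
      have "x [^] (2::nat) \<in> squares R A"
        using x by (simp add: squares_def)
      then have "x \<oplus> b \<in> A <+>\<^bsub>R\<^esub> A" "x [^] (2::nat) \<oplus> c \<in> squares R A <+>\<^bsub>R\<^esub> squares R A"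
        using x b c unfolding set_add_def' by blast+
      moreover have "g b (x \<oplus> b) = x [^] (2::nat)"
        using subsetD[OF A(1) x] subsetD[OF A(1) b] by (simp add: g_def a_minus_def a_assoc r_neg)
      ultimately show "?f v \<in> (SIGMA p:P. I p)"
        using b c by (simp add: v P_def I_def L_def)
    qed
  qed (use finP finI in simp)
  also have "\<dots> = (\<Sum>p\<in>P. card (I p))"
    using finP finI by (simp add: card_SigmaI)
  finally have "real (card A ^ 2 * card (squares R A)) \<le> real (\<Sum>p\<in>P. card (I p))"
    by (rule of_nat_mono)
  then have lower: "a\<^sup>2 * u \<le> real (\<Sum>p\<in>P. card (I p))"
    by (simp add: a_def u_def)
  have "(real (\<Sum>p\<in>P. card (I p)) - real (card P) * real (card L) / real (card ?C))\<^sup>2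
    \<le> real (card P) * real (card L) * (real (card ?C) * real (card M))"
    unfolding I_def
  proof (rule incidence_bound[where g = g])
    show "g b x \<in> ?C" if "b \<in> ?C" "x \<in> ?C" for b x
      using that by (simp add: g_def)
    show "M \<subseteq> ?C"
      using M.Icarr by blast
  qed (fact fin far LC PC)+
  moreover have "real (card P) = W" "real (card L) = a * u"
    by (simp_all add: W_def P_def L_def a_def u_def card_cartesian_product)
  ultimately have upper: "(real (\<Sum>p\<in>P. card (I p)) - W * (a * u) / n)\<^sup>2 \<le> W * (a * u) * (n * real (card M))"
    by (simp add: n_def)
  have pos: "a > 0" "u > 0" "n > 0"
    using A finite_subset[OF A(1) fin] fin by (auto simp: a_def u_def n_def squares_def card_gt_0_iff)
  show ?thesis
  proof (rule disjCI)
    assume "\<not> a ^ 3 * u \<le> 4 * W * (n * real (card M))"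
    \<comment> \<open>The factor \<open>a * u\<close> turns the right side into four times the
      square of a^2 u / 2, so that it compares directly with \<open>upper\<close>: the deviation is
      below half of the lower bound, and the main term must supply the other half.\<close>
    then have "(a * u) * (4 * W * (n * real (card M))) < (a * u) * (a ^ 3 * u)"
      using pos by (intro mult_strict_left_mono) auto
    then have "W * (a * u) * (n * real (card M)) < (a\<^sup>2 * u / 2)\<^sup>2"
      by (simp add: power2_eq_square power3_eq_cube field_simps)
    with upper have "(real (\<Sum>p\<in>P. card (I p)) - W * (a * u) / n)\<^sup>2 < (a\<^sup>2 * u / 2)\<^sup>2"
      by simp
    then have "real (\<Sum>p\<in>P. card (I p)) - W * (a * u) / n < a\<^sup>2 * u / 2"
      by (rule power2_less_imp_less) (use pos in simp)
    with lower have "(a * u) * (a / 2) < (a * u) * (W / n)"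
      by (simp add: power2_eq_square field_simps)
    then have "a / 2 < W / n"
      using pos by (simp only: mult_less_cancel_left_pos mult_pos_pos)
    then show "a * n \<le> 2 * W"
      using pos by (simp add: field_simps)
  qed
qed

section \<open>Numerical estimates and conclusion\<close>

text \<open>Here \<open>n\<close>, \<open>m\<close>, \<open>a\<close>, \<open>s\<close>,
  \<open>t\<close>, \<open>u\<close> are the sizes of R, its maximal ideal, A, A + A, A^2 + A^2 and
  A^2. From \<open>large\<close> and \<open>s \<le> n\<close> follows q m^2 < a^2, so
  \<open>m\<close> is a proper fraction of \<open>a\<close> and \<open>u\<close> is at least a / 5.
  The constant 100 is 4 * 5^2: the 4 comes from the second alternative, and the bound on
  \<open>u\<close> is used twice.\<close>

lemma sumset_squares_real_bound:
  fixes a n m q s t u :: real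
  assumes n: "n = q * m" and q: "q \<ge> 3" and large: "n ^ 3 < s * a\<^sup>2 * q"
    and s: "s \<le> n" and a: "0 < a" "a \<le> n" and u: "a - m \<le> 2 * u" "u \<le> t" and m: "m > 0"
    and X: "a * n \<le> 2 * (t * s) \<or> a ^ 3 * u \<le> 4 * (t * s) * (n * m)"
  shows "n * a ^ 3 \<le> 100 * (t * s)\<^sup>2"
proof -
  have npos: "n > 0"
    using n q m by simp
  then have "0 < s * (a\<^sup>2 * q)"
    using large by (smt (verit) mult.assoc zero_less_power)
  then have spos: "s > 0"
    using a q by (intro zero_less_mult_pos2[of s "a\<^sup>2 * q"]) auto
  have "n * n\<^sup>2 < n * (a\<^sup>2 * q)"
  proof -
    have "s * (a\<^sup>2 * q) \<le> n * (a\<^sup>2 * q)"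
      using s q by (intro mult_right_mono) auto
    with large show ?thesis
      by (simp add: power2_eq_square power3_eq_cube mult_ac)
  qed
  then have "n\<^sup>2 < a\<^sup>2 * q"
    using npos by simp
  then have "q * (q * m\<^sup>2) < q * a\<^sup>2"
    by (simp add: n power2_eq_square mult_ac)
  then have "q * m\<^sup>2 < a\<^sup>2"
    using q by simp
  then have "3 * m\<^sup>2 < a\<^sup>2"
    using mult_right_mono[OF q, of "m\<^sup>2"] by simp
  \<comment> \<open>Since 25/9 < 3, the rational 3/5 replaces the square root of 1/3; then
    \<open>a - m\<close> exceeds 2a/5, whence \<open>a \<le> 5 * u\<close>.\<close>
  then have "25 * m\<^sup>2 < 9 * a\<^sup>2"
    using zero_le_power2[of m] by linarith
  then have "m\<^sup>2 < (3 / 5 * a)\<^sup>2"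
    by (simp add: power_divide power_mult_distrib)
  then have "m < 3 / 5 * a"
    by (rule power2_less_imp_less) (use a in simp)
  then have ua: "a \<le> 5 * u"
    using u by simp
  from X show ?thesis
  proof
    assume "a * n \<le> 2 * (t * s)"
    then have "(a * n)\<^sup>2 \<le> (2 * (t * s))\<^sup>2"
      using a npos by (intro power_mono) auto
    moreover have "(n * a\<^sup>2) * a \<le> (n * a\<^sup>2) * n"
      using a npos by (intro mult_left_mono) auto
    then have "n * a ^ 3 \<le> (a * n)\<^sup>2"
      by (simp add: power2_eq_square power3_eq_cube mult_ac)
    moreover have "(2 * (t * s))\<^sup>2 = 4 * (t * s)\<^sup>2"
      by (simp add: power_mult_distrib)
    ultimately show ?thesis
      using zero_le_power2[of "t * s"] by linarith
  next
    assume X: "a ^ 3 * u \<le> 4 * (t * s) * (n * m)"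
    have "s * a \<le> s * (5 * t)"
      using ua u spos by (intro mult_left_mono) auto
    then have sa: "s * a \<le> 5 * (t * s)"
      by (simp add: mult_ac)
    have "a ^ 3 * a \<le> a ^ 3 * (5 * u)"
      using ua a by (intro mult_left_mono) auto
    then have "a ^ 4 \<le> 5 * (a ^ 3 * u)"
      by (simp add: power_numeral_reduce mult_ac)
    then have "s * a * a ^ 4 \<le> 5 * (t * s) * (5 * (a ^ 3 * u))"
      using sa mult_pos_pos[OF spos a(1)] a by (intro mult_mono[OF sa]) auto
    also have "\<dots> \<le> 5 * (t * s) * (5 * (4 * (t * s) * (n * m)))"
      using X sa mult_pos_pos[OF spos a(1)] by (intro mult_left_mono) auto
    \<comment> \<open>The factor \<open>q\<close> completes n m to n^2 on the right and s a^2 to the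
      left side of \<open>large\<close>'s reverse estimate, s a^2 q > n^3; a factor n^2 then
      cancels.\<close>
    finally have "q * (s * a * a ^ 4) \<le> q * (5 * (t * s) * (5 * (4 * (t * s) * (n * m))))"
      using q by (intro mult_left_mono) auto
    also have "\<dots> = 100 * (t * s)\<^sup>2 * n\<^sup>2"
      using n by (simp add: power2_eq_square mult_ac)
    finally have "(s * a\<^sup>2 * q) * a ^ 3 \<le> 100 * (t * s)\<^sup>2 * n\<^sup>2"
      by (simp add: power_numeral_reduce mult_ac)
    moreover have "n ^ 3 * a ^ 3 \<le> (s * a\<^sup>2 * q) * a ^ 3"
      using large a by (intro mult_right_mono) auto
    ultimately have "(n * a ^ 3) * n\<^sup>2 \<le> 100 * (t * s)\<^sup>2 * n\<^sup>2"
      by (simp add: power_numeral_reduce mult_ac)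
    then show ?thesis
      using npos by simp
  qed
qed

lemma (in cring) sumset_squares_bound:
  assumes R: "finite_valuation_ring_of_order R q r" and q: "odd q"
    and A: "A \<subseteq> carrier R" "A \<noteq> {}"
    and large: "card (A <+>\<^bsub>R\<^esub> A) * card A ^ 2 > q ^ (3 * r - 1)"
  shows "real (q ^ r) * real (card A) ^ 3
    \<le> 100 * (real (card (squares R A <+>\<^bsub>R\<^esub> squares R A)) * real (card (A <+>\<^bsub>R\<^esub> A)))\<^sup>2"
proof -
  let ?C = "carrier R"
  obtain M where M: "maximalideal M R" and qM: "card (carrier (R Quot M)) = q"
    and nilp: "nilpotency_index R M r" and r: "r \<ge> 1"
    using R by (auto simp: finite_valuation_ring_of_order_def)
  interpret M: maximalideal M R by fact
  have fin: "finite ?C" and "principalideal M R"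
    using R M.ideal_axioms by (auto simp: finite_valuation_ring_of_order_def finite_valuation_ring_def)
  then obtain p where p: "p \<in> ?C" and MP: "M = PIdl p"
    using principalideal.generate cgenideal_eq_genideal by metis
  have PIdl0: "PIdl x = {\<zero>} \<longleftrightarrow> x = \<zero>" if "x \<in> ?C" for x
    using that cgenideal_self[of x] by (auto simp: cgenideal_def intro: exI[of _ \<zero>])
  have nil: "p [^] r = \<zero>"
    using nilp p PIdl0 by (auto simp: nilpotency_index_def MP ideals_set_pow_PIdl)
  have nz: "p [^] k \<noteq> \<zero>" if "k < r" for k
    using nilp p PIdl0 that by (auto simp: nilpotency_index_def MP ideals_set_pow_PIdl)
  have nilM: "m [^] r = \<zero>" if "m \<in> M" for m
    using PIdl_nilpotent[OF p nil] that by (simp add: MP)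
  have n: "card ?C = q ^ r"
    using card_nilpotent_PIdl[OF M[unfolded MP] p nil nz] qM[unfolded MP] by simp
  have nm: "card ?C = q * card M"
    using a_lagrange[OF fin M.is_additive_subgroup] qM by (simp add: FactRing_def order_def)
  have cardM: "card M > 0"
    using M.zero_closed finite_subset[OF M.a_subset fin] by (metis card_gt_0_iff empty_iff)
  \<comment> \<open>If q were 1 the maximal ideal would be the whole ring; an odd \<open>q\<close>
    other than 1 is at least 3.\<close>
  have "q \<noteq> 1"
    using nm card_subset_eq[OF fin M.a_subset] M.I_notcarr by auto
  with q have q3: "q \<ge> 3"
    by presburger
  note cancel = nil_maximal_cancel[OF M nilM]
  have double: "x \<oplus> x \<notin> M" if "x \<in> ?C" "x \<notin> M" for x
    using odd_card_double_notin_ideal[OF fin _ M.ideal_axioms that] n q by simp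
  have finA: "finite A" and sqC: "squares R A \<subseteq> ?C"
    using A finite_subset[OF _ fin] by (auto simp: squares_def)
  have sumC: "A <+>\<^bsub>R\<^esub> A \<subseteq> ?C" "squares R A <+>\<^bsub>R\<^esub> squares R A \<subseteq> ?C"
    using set_add_closed A sqC by auto
  \<comment> \<open>Inside \<open>M\<close> nothing is known about squaring, so that portion of
    \<open>A\<close> is bounded by |M|; outside \<open>M\<close> squaring is at most
    two-to-one.\<close>
  have u: "card A \<le> card M + 2 * card (squares R A)"
  proof -
    have "card A \<le> card (A \<inter> M) + card (A - M)"
      using card_Un_le[of "A \<inter> M" "A - M"] by (simp add: Int_Diff_Un)
    also have "card (A \<inter> M) \<le> card M"
      using finite_subset[OF M.a_subset fin] by (intro card_mono) auto
    also have "card (A - M) \<le> 2 * card (squares R (A - M))"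
      by (rule card_le_twice_card_squares[OF fin M.ideal_axioms cancel double]) (use A in auto)
    also have "card (squares R (A - M)) \<le> card (squares R A)"
      using finA by (intro card_mono) (auto simp: squares_def)
    finally show ?thesis by simp
  qed
  have t: "card (squares R A) \<le> card (squares R A <+>\<^bsub>R\<^esub> squares R A)"
  proof -
    obtain z where z: "z \<in> squares R A"
      using A by (auto simp: squares_def)
    show ?thesis
    proof (rule card_inj_on_le)
      show "inj_on (\<lambda>x. x \<oplus> z) (squares R A)"
        using sqC z by (auto simp: inj_on_def subset_iff)
      show "(\<lambda>x. x \<oplus> z) ` squares R A \<subseteq> squares R A <+>\<^bsub>R\<^esub> squares R A"
        using z by (auto simp: set_add_def')
    qed (rule finite_subset[OF sumC(2) fin])
  qed
  \<comment> \<open>As \<open>r \<ge> 1\<close>, the natural subtraction does not truncate;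
    multiplying the hypothesis by \<open>q\<close> compares it with |R|^3.\<close>
  have "q * q ^ (3 * r - 1) = (q ^ r) ^ 3"
    using r by (simp add: power_mult[symmetric] mult.commute flip: power_Suc)
  then have "card ?C ^ 3 < card (A <+>\<^bsub>R\<^esub> A) * card A ^ 2 * q"
    using large q3 n by (metis mult.commute mult_less_cancel2 not_numeral_le_zero gr0I)
  then have large': "real (card ?C) ^ 3 < real (card (A <+>\<^bsub>R\<^esub> A)) * real (card A) ^ 2 * real q"
    by (simp flip: of_nat_mult of_nat_power)
  have "real (card ?C) * real (card A) ^ 3
      \<le> 100 * (real (card (squares R A <+>\<^bsub>R\<^esub> squares R A)) * real (card (A <+>\<^bsub>R\<^esub> A)))\<^sup>2"
  proof (rule sumset_squares_real_bound[OF _ _ large'])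
    show "real (card ?C) = real q * real (card M)"
      by (simp add: nm)
    show "real (card A) - real (card M) \<le> 2 * real (card (squares R A))"
      using u by linarith
    show "real (card A) * real (card ?C)
          \<le> 2 * (real (card (squares R A <+>\<^bsub>R\<^esub> squares R A)) * real (card (A <+>\<^bsub>R\<^esub> A))) \<or>
        real (card A) ^ 3 * real (card (squares R A))
          \<le> 4 * (real (card (squares R A <+>\<^bsub>R\<^esub> squares R A)) * real (card (A <+>\<^bsub>R\<^esub> A)))
            * (real (card ?C) * real (card M))"
      by (rule sumset_squares_incidences[OF fin M.ideal_axioms cancel double A])
    show "0 < real (card A)"
      using A finA by (simp add: card_gt_0_iff)
  qed (use q3 t cardM A sumC fin in \<open>simp_all add: card_mono\<close>)
  then show ?thesis
    by (simp add: n)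
qed

theorem theorem1p2:
  shows "\<exists>c::real. c > 0 \<and>
    (\<forall>(R :: 'a ring) (q :: nat) (r :: nat) (A :: 'a set).
       finite_valuation_ring_of_order R q r \<longrightarrow> odd q \<longrightarrow>
       A \<subseteq> carrier R \<longrightarrow> A \<noteq> {} \<longrightarrow>
       card (A <+>\<^bsub>R\<^esub> A) * card A ^ 2 > q ^ (3 * r - 1) \<longrightarrow>
       real (card (squares R A <+>\<^bsub>R\<^esub> squares R A)) * real (card (A <+>\<^bsub>R\<^esub> A))
         \<ge> c * (real q powr (real r / 2) * real (card A) powr (3 / 2)))"
proof (intro exI[of _ "1 / 10"] conjI allI impI)
  fix R :: "'a ring" and q r :: nat and A :: "'a set"
  assume R: "finite_valuation_ring_of_order R q r" and q: "odd q" and A: "A \<subseteq> carrier R" "A \<noteq> {}"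
    and large: "card (A <+>\<^bsub>R\<^esub> A) * card A ^ 2 > q ^ (3 * r - 1)"
  let ?X = "real (card (squares R A <+>\<^bsub>R\<^esub> squares R A)) * real (card (A <+>\<^bsub>R\<^esub> A))"
  let ?Y = "real q powr (real r / 2) * real (card A) powr (3 / 2)"
  have "cring R" "finite (carrier R)"
    using R unfolding finite_valuation_ring_of_order_def finite_valuation_ring_def by blast+
  then have a: "real (card A) > 0"
    using A finite_subset[OF A(1)] by (simp add: card_gt_0_iff)
  have q0: "real q > 0"
    using odd_pos[OF q] by simp
  \<comment> \<open>Squaring clears the fractional exponents, and the constant 100 of the squared
    bound becomes c = 1/10.\<close>
  have "(real q powr (real r / 2))\<^sup>2 = real q ^ r"
    using q0 by (subst powr_power) (simp_all add: powr_realpow)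
  moreover have "(real (card A) powr (3 / 2))\<^sup>2 = real (card A) ^ 3"
    using a powr_realpow[of "real (card A)" 3] by (subst powr_power) simp_all
  ultimately have "?Y\<^sup>2 = real (q ^ r) * real (card A) ^ 3"
    by (simp add: power_mult_distrib)
  also have "\<dots> \<le> (10 * ?X)\<^sup>2"
    using cring.sumset_squares_bound[OF \<open>cring R\<close> R q A large] by (simp add: power_mult_distrib)
  finally have "?Y \<le> 10 * ?X"
    by (rule power2_le_imp_le) simp
  then show "1 / 10 * ?Y \<le> ?X"
    by simp
qed simp

end
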